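(* Let $F\colon[0,1]\to[0,1]$ be monotone with respect to the usual order and $\gamma$-Lipschitz for some constant $0<\gamma<1$, i.e. $|F(x)-F(y)|\leq\gamma|x-y|$ for all $x,y\in[0,1]$. Define approximants $V^{0}=0$, $V^{\beta+1}=F(V^{\beta})$, $V^{\lambda}=\sup_{\beta<\lambda}V^{\beta}$ for limit ordinals $\lambda$, and let $\kappa$ be the least ordinal $\alpha<\omega_1$ with $V^{\alpha}=V^{\alpha+1}$. Then for every $\alpha<\kappa$, $$|V^{\kappa}-V^{\alpha}|\leq\gamma^{\alpha}.$$ Consequently, for $0<\varepsilon<1$, every $\alpha$ with $\alpha\geq\lceil\log_{\gamma}\varepsilon\rceil$ satisfies $|V^{\kappa}-V^{\alpha}|\leq\varepsilon$.
   Context: $[0,1]$ carries the usual order and the metric $|x-y|$ (the paper writes this as an $\ell_1$-norm). For finite $\alpha$, $\gamma^\alpha$ is the ordinary real power; for infinite ordinals $\alpha$, $\gamma^\alpha$ is read as $\lim_{n\to\infty}\gamma^n=0$. $\omega_1$ is the first uncountable ordinal. *)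

theory Defs
  imports "HOL-Analysis.Analysis"
begin

text \<open>
  Ordinals are elements of an arbitrary type of class \<open>wellorder\<close>: an element \<open>a\<close> stands for
  the order type of \<open>{..<a}\<close>.  Thus \<open>a\<close> is below the first uncountable ordinal iff
  \<open>{..<a}\<close> is countable, and a type with uncountable universe contains all countable ordinals
  (and, depending on the type, possibly larger ones).
\<close>

definition ord_zero :: "'o::wellorder"
  where "ord_zero = (LEAST a. True)"

text \<open>The value at a greatest element, which has no successor in the type, is irrelevant.\<close>

definition ord_suc :: "'o::wellorder \<Rightarrow> 'o"
  where "ord_suc a = (LEAST b. a < b)"

definition is_suc :: "'o::wellorder \<Rightarrow> bool"
  where "is_suc a \<longleftrightarrow> (\<exists>b<a. a = ord_suc b)"

definition is_limit :: "'o::wellorder \<Rightarrow> bool"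
  where "is_limit a \<longleftrightarrow> a \<noteq> ord_zero \<and> \<not> is_suc a"

definition ord_pred :: "'o::wellorder \<Rightarrow> 'o"
  where "ord_pred a = (THE b. b < a \<and> a = ord_suc b)"

definition ord_of_nat :: "nat \<Rightarrow> 'o::wellorder"
  where "ord_of_nat n = (ord_suc ^^ n) ord_zero"

lemma ord_zero_le: "ord_zero \<le> a"
  unfolding ord_zero_def by (rule Least_le) simp

lemma less_ord_suc: "a < c \<Longrightarrow> a < ord_suc a"
  unfolding ord_suc_def by (rule LeastI)

lemma ord_suc_le: "a < c \<Longrightarrow> ord_suc a \<le> c"
  unfolding ord_suc_def by (rule Least_le)

lemma ord_pred_unique:
  assumes "b < ord_suc b" "c < ord_suc b" "ord_suc b = ord_suc c"
  shows "c = b"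
  using assms by (metis leD linorder_neqE ord_suc_le)

lemma ord_pred_suc: "b < ord_suc b \<Longrightarrow> ord_pred (ord_suc b) = b"
  unfolding ord_pred_def by (rule the_equality) (auto intro: ord_pred_unique)

lemma ord_pred_less: "is_suc a \<Longrightarrow> ord_pred a < a"
  by (metis is_suc_def ord_pred_suc)

text \<open>
  The approximants by transfinite recursion; \<open>approx_zero\<close>, \<open>approx_suc\<close>, \<open>approx_limit\<close> give
  its three clauses.
\<close>

function approx :: "(real \<Rightarrow> real) \<Rightarrow> 'o::wellorder \<Rightarrow> real"
  where "approx F a =
    (if a = ord_zero then 0
     else if is_suc a then F (approx F (ord_pred a))
     else Sup (approx F ` {..<a}))"
  by pat_completeness auto
termination
  by (relation "inv_image {(x, y). x < y} snd") (auto simp: wf ord_pred_less)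

declare approx.simps [simp del]

lemma approx_zero: "approx F ord_zero = 0"
  by (simp add: approx.simps)

lemma approx_suc:
  assumes "a < c"
  shows "approx F (ord_suc a) = F (approx F a)"
proof -
  have less: "a < ord_suc a"
    by (rule less_ord_suc[OF assms])
  then have "ord_suc a \<noteq> ord_zero"
    using ord_zero_le[of a] by auto
  moreover have "is_suc (ord_suc a)"
    using less by (auto simp: is_suc_def)
  ultimately show ?thesis
    using less by (subst approx.simps) (simp add: ord_pred_suc)
qed

lemma approx_limit:
  assumes "is_limit l"
  shows "approx F l = (SUP b\<in>{..<l}. approx F b)"
  using assms by (subst approx.simps) (simp add: is_limit_def)

text \<open>The least countable ordinal at which the approximants become stationary.\<close>

definition closure_ord :: "(real \<Rightarrow> real) \<Rightarrow> 'o::wellorder"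
  where "closure_ord F =
    (LEAST a. countable {..<a} \<and> approx F a = approx F (ord_suc a))"

definition ord_power :: "real \<Rightarrow> 'o::wellorder \<Rightarrow> real"
  where "ord_power \<gamma> a =
    (if finite {..<a} then \<gamma> ^ card {..<a} else lim (\<lambda>n. \<gamma> ^ n))"

text \<open>
  Well-ordered types with uncountable universe exist: \<^typ>\<open>nat suc\<close> carries a well-order of
  order type the first uncountable ordinal.
\<close>

typedef omega1 = "UNIV :: nat suc set"
  by simp

lemma card_suc_natLeq:
  includes cardinal_syntax
  shows "card_order (card_suc natLeq)" "natLeq <o card_suc natLeq"
  by (simp_all add: card_order_card_suc card_suc_greater natLeq_card_order)

instantiation omega1 :: wellorder
begin

definition "a \<le> b \<longleftrightarrow> (Rep_omega1 a, Rep_omega1 b) \<in> card_suc natLeq" for a b :: omega1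

definition "a < b \<longleftrightarrow> a \<le> b \<and> a \<noteq> b" for a b :: omega1

instance
proof -
  let ?r = "card_suc natLeq"
  have wo: "well_order_on UNIV ?r"
    using card_suc_natLeq(1) by (simp add: card_order_on_def)
  then have r: "refl ?r" "trans ?r" "antisym ?r" "total ?r" "wf (?r - Id)"
    by (auto simp: order_on_defs)
  have le: "a \<le> b \<longleftrightarrow> (Rep_omega1 a, Rep_omega1 b) \<in> ?r" for a b
    by (rule less_eq_omega1_def)
  show "OFCLASS(omega1, wellorder_class)"
  proof (intro_classes)
    fix x y z :: omega1
    show "x \<le> x"
      using r(1) by (auto simp: le refl_on_def)
    show "x \<le> y \<Longrightarrow> y \<le> z \<Longrightarrow> x \<le> z"
      using r(2) unfolding le by (rule transD)
    show antisym: "x \<le> y \<Longrightarrow> y \<le> x \<Longrightarrow> x = y" for x y :: omega1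
      using r(3) unfolding le by (metis Rep_omega1_inject antisymD)
    show "x < y \<longleftrightarrow> x \<le> y \<and> \<not> y \<le> x"
      using antisym r(1) by (auto simp: less_omega1_def le refl_on_def)
    show "x \<le> y \<or> y \<le> x"
      using r(1,4) unfolding le by (metis UNIV_I refl_on_def total_on_def)
  next
    fix P :: "omega1 \<Rightarrow> bool" and a
    assume step: "\<And>x. (\<And>y. y < x \<Longrightarrow> P y) \<Longrightarrow> P x"
    have "wf (inv_image (?r - Id) Rep_omega1)"
      using r(5) by (rule wf_inv_image)
    moreover have "inv_image (?r - Id) Rep_omega1 = {(x, y). x < y}"
      by (auto simp: less_omega1_def le Rep_omega1_inject)
    ultimately show "P a"
      using step by (metis (no_types, lifting) case_prodI mem_Collect_eq wf_induct_rule)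
  qed
qed

end

lemma uncountable_omega1:
  includes cardinal_syntax
  shows "uncountable (UNIV :: omega1 set)"
proof
  assume "countable (UNIV :: omega1 set)"
  then have "countable (range Rep_omega1)"
    by (rule countable_image)
  moreover have "range Rep_omega1 = UNIV"
    using Abs_omega1_inverse by (metis UNIV_I surjI)
  ultimately have "countable (UNIV :: nat suc set)"
    by simp
  then have "|UNIV :: nat suc set| \<le>o |UNIV :: nat set|"
    by (metis countableE card_of_ordLeq subset_UNIV)
  moreover have "|UNIV :: nat suc set| =o card_suc natLeq"
    using card_suc_natLeq(1) card_of_unique ordIso_symmetric by blast
  moreover have "|UNIV :: nat set| =o natLeq"
    by (rule card_of_nat)
  ultimately have "card_suc natLeq \<le>o natLeq"
    by (meson ordIso_ordLeq_trans ordIso_symmetric ordLeq_ordIso_trans)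
  then show False
    using card_suc_natLeq(2) not_ordLess_ordLeq by blast
qed

end

(* The contraction F has a unique fixed point p. By transfinite induction the gap p - V^a lies
   between 0 and gamma^a: successor steps contract it by gamma, and at a limit stage the gap is below
   every gamma^n, hence 0. So V^a = p for all infinite a, which yields a countable stationary
   stage; and any non-greatest stationary stage is a fixed point of F, hence equals p. *)
theory Submission
  imports Defs
begin

lemma lessThan_ord_zero: "{..<ord_zero} = {}"
  by (simp add: lessThan_def leD ord_zero_le)

lemma lessThan_ord_suc:
  assumes "a < c"
  shows "{..<ord_suc a} = insert a {..<a}"
  using less_ord_suc[OF assms] by (auto dest: ord_suc_le) (metis leD neqE ord_suc_le)

text \<open>\<open>ord_suc\<close> means a genuine successor only below some larger element. A
  greatest element with countably many predecessors would make the whole type countable.\<close>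

lemma countable_imp_less:
  assumes "uncountable (UNIV :: 'o::wellorder set)" and "countable {..<a::'o}"
  shows "\<exists>c. a < c"
proof (rule ccontr)
  assume "\<nexists>c. a < c"
  then have "(UNIV :: 'o set) \<subseteq> insert a {..<a}"
    by (auto simp: not_less order_le_less)
  then show False
    using assms countable_subset by blast
qed

text \<open>The witness is the ordinal omega, taken as the least element with infinitely many
  predecessors.\<close>

lemma ex_countable_infinite_lessThan:
  assumes "uncountable (UNIV :: 'o::wellorder set)"
  shows "\<exists>a::'o. countable {..<a} \<and> infinite {..<a}"
proof -
  have ex: "\<exists>a::'o. infinite {..<a}"
  proof (rule ccontr)
    assume "\<nexists>a::'o. infinite {..<a}"
    then have fin: "finite {..<a}" for a :: 'o
      by blast
    \<comment> \<open>If all initial segments were finite, their cardinalities would embed the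
      uncountable type into the naturals. Below omega the same map shows countability.\<close>
    have "strict_mono (\<lambda>a::'o. card {..<a})"
      by (intro strict_monoI psubset_card_mono fin) auto
    then show False
      using assms countableI strict_mono_imp_inj_on by blast
  qed
  define a where "a = (LEAST a::'o. infinite {..<a})"
  have a: "infinite {..<a}" "\<And>b. b < a \<Longrightarrow> finite {..<b}"
    unfolding a_def using LeastI_ex[OF ex] not_less_Least by blast+
  have "inj_on (\<lambda>b. card {..<b}) {..<a}"
    using a(2) by (intro strict_mono_on_imp_inj_on strict_mono_onI psubset_card_mono) auto
  then show ?thesis
    using a(1) countableI by blast
qed

lemma finite_card_lessThan_ord_of_nat:
  assumes "uncountable (UNIV :: 'o::wellorder set)"
  shows "finite {..<ord_of_nat n :: 'o} \<and> card {..<ord_of_nat n :: 'o} = n"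
proof (induction n)
  case 0
  show ?case
    by (simp add: ord_of_nat_def lessThan_ord_zero)
next
  case (Suc n)
  then have "countable {..<ord_of_nat n :: 'o}"
    by (simp add: countable_finite)
  then obtain c where "(ord_of_nat n :: 'o) < c"
    using countable_imp_less[OF assms] by metis
  then have "{..<ord_of_nat (Suc n) :: 'o} = insert (ord_of_nat n) {..<ord_of_nat n}"
    by (simp add: ord_of_nat_def lessThan_ord_suc)
  then show ?case
    using Suc by simp
qed

lemma ord_power_eq:
  assumes "0 < \<gamma>" and "\<gamma> < 1"
  shows "ord_power \<gamma> a = (if finite {..<a} then \<gamma> ^ card {..<a} else 0)"
  using assms limI[OF LIMSEQ_power_zero[of \<gamma>]] by (simp add: ord_power_def)

lemma ord_power_suc:
  assumes "0 < \<gamma>" and "\<gamma> < 1" and "a < c"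
  shows "ord_power \<gamma> (ord_suc a) = \<gamma> * ord_power \<gamma> a"
  using assms by (simp add: ord_power_eq lessThan_ord_suc)

lemma ord_power_antimono:
  assumes "0 < \<gamma>" and "\<gamma> < 1" and "a \<le> b"
  shows "ord_power \<gamma> b \<le> ord_power \<gamma> a"
proof (cases "finite {..<b}")
  case True
  moreover have "{..<a} \<subseteq> {..<b}"
    using assms(3) by auto
  ultimately have "finite {..<a}" "card {..<a} \<le> card {..<b}"
    by (auto intro: finite_subset card_mono)
  then show ?thesis
    using True assms by (simp add: ord_power_eq power_decreasing)
qed (use assms in \<open>simp add: ord_power_eq\<close>)

text \<open>A limit is never reached by successors, so iterating \<open>ord_suc\<close> from
  \<open>ord_zero\<close> stays below it, and each step multiplies the power by
  \<open>\<gamma>\<close>.\<close>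

lemma ex_ord_power_le_below_limit:
  assumes "is_limit l" and "0 < \<gamma>" and "\<gamma> < 1"
  shows "\<exists>b<l. ord_power \<gamma> b \<le> \<gamma> ^ n"
proof (induction n)
  case 0
  have "ord_zero < l"
    using assms(1) ord_zero_le[of l] by (auto simp: is_limit_def order_le_less)
  then show ?case
    using assms by (auto simp: ord_power_eq intro!: exI[of _ "ord_zero"] power_le_one)
next
  case (Suc n)
  then obtain b where b: "b < l" "ord_power \<gamma> b \<le> \<gamma> ^ n"
    by blast
  then have "ord_suc b < l"
    using assms(1) ord_suc_le[OF b(1)] by (auto simp: is_limit_def is_suc_def order_le_less)
  moreover have "ord_power \<gamma> (ord_suc b) \<le> \<gamma> ^ Suc n"
    using b assms by (simp add: ord_power_suc mult_left_mono)
  ultimately show ?case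
    by blast
qed

text \<open>Measuring the gap to \<open>p\<close> keeps the induction independent of
  \<open>closure_ord\<close>. The bounds by 0 and \<open>p\<close> are carried along because
  \<open>F\<close> is controlled only on \<open>{0..1}\<close>.\<close>

lemma approx_fixpoint_gap:
  fixes F :: "real \<Rightarrow> real" and a :: "'o::wellorder"
  assumes "mono_on {0..1} F" and "0 < \<gamma>" and "\<gamma> < 1" and lip: "\<gamma>-lipschitz_on {0..1} F"
    and F: "F \<in> {0..1} \<rightarrow> {0..1}" and p: "p \<in> {0..1}" "F p = p"
  shows "0 \<le> approx F a \<and> approx F a \<le> p \<and> p - approx F a \<le> ord_power \<gamma> a"
proof (induction a rule: less_induct)
  case (less a)
  consider "a = ord_zero" | b where "b < a" "a = ord_suc b" | "is_limit a"
    by (auto simp: is_limit_def is_suc_def)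
  then show ?case
  proof cases
    case 1
    then show ?thesis
      using p assms by (simp add: approx_zero ord_power_eq lessThan_ord_zero)
  next
    case 2
    define x where "x = approx F b"
    have x: "0 \<le> x" "x \<le> p" "p - x \<le> ord_power \<gamma> b"
      using less.IH[OF 2(1)] by (auto simp: x_def)
    then have "x \<in> {0..1}"
      using p by auto
    \<comment> \<open>As \<open>F p = p\<close>, monotonicity keeps the next stage below
      \<open>p\<close>, and the Lipschitz bound contracts the gap.\<close>
    then have "F x \<le> p" "F x \<in> {0..1}" "p - F x \<le> \<gamma> * (p - x)"
      using mono_onD[OF assms(1), of x p] F lipschitz_onD[OF lip, of p x] p x
      by (auto simp: dist_real_def)
    moreover have "\<gamma> * (p - x) \<le> \<gamma> * ord_power \<gamma> b"
      using x assms(2) by (intro mult_left_mono) auto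
    moreover have "approx F a = F x" "ord_power \<gamma> a = \<gamma> * ord_power \<gamma> b"
      using 2 assms(2,3) by (simp_all add: approx_suc ord_power_suc x_def)
    ultimately show ?thesis
      by simp
  next
    case 3
    have V: "approx F a = (SUP b\<in>{..<a}. approx F b)"
      using approx_limit[OF 3] .
    \<comment> \<open>A real \<open>Sup\<close> is a least upper bound only for bounded nonempty
      sets: the induction hypothesis supplies the bound \<open>p\<close>, and \<open>b0\<close>
      below supplies an element.\<close>
    have bdd: "bdd_above (approx F ` {..<a})"
      using less.IH by (auto intro!: bdd_aboveI)
    have upper: "approx F b \<le> approx F a" if "b < a" for b
      unfolding V using that bdd by (auto intro: cSUP_upper)
    obtain b0 where "b0 < a"
      using ex_ord_power_le_below_limit[OF 3 assms(2,3)] by blast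
    then have "approx F a \<le> p"
      unfolding V using less.IH by (auto intro!: cSUP_least)
    moreover have "0 \<le> approx F a"
      using less.IH[OF \<open>b0 < a\<close>] upper[OF \<open>b0 < a\<close>] by linarith
    moreover have "p - approx F a \<le> \<gamma> ^ n" for n
    proof -
      obtain b where "b < a" "ord_power \<gamma> b \<le> \<gamma> ^ n"
        using ex_ord_power_le_below_limit[OF 3 assms(2,3)] by blast
      then show ?thesis
        using less.IH[of b] upper[of b] by linarith
    qed
    then have "p - approx F a \<le> 0"
      using assms(2,3) by (intro LIMSEQ_le_const[OF LIMSEQ_power_zero[of \<gamma>]]) auto
    moreover have "0 \<le> ord_power \<gamma> a"
      using assms by (simp add: ord_power_eq)
    ultimately show ?thesis
      by linarith
  qed
qed

text \<open>For a base below 1, rounding the exponent up only lowers the power; so does the clipping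
  of negative exponents to 0 by \<open>nat\<close>.\<close>

lemma power_nat_ceiling_log_le:
  fixes \<gamma> \<epsilon> :: real
  assumes "0 < \<gamma>" and "\<gamma> < 1" and "0 < \<epsilon>"
  shows "\<gamma> ^ nat \<lceil>log \<gamma> \<epsilon>\<rceil> \<le> \<epsilon>"
proof -
  have "\<gamma> ^ nat \<lceil>log \<gamma> \<epsilon>\<rceil> = \<gamma> powr real (nat \<lceil>log \<gamma> \<epsilon>\<rceil>)"
    using assms by (simp add: powr_realpow)
  also have "\<dots> \<le> \<gamma> powr log \<gamma> \<epsilon>"
    using assms by (intro powr_mono') (auto intro: real_nat_ceiling_ge)
  also have "\<dots> = \<epsilon>"
    using assms by simp
  finally show ?thesis .
qed

theorem theoremA8:
  fixes F :: "real \<Rightarrow> real" and \<gamma> :: real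
  assumes "uncountable (UNIV :: 'o::wellorder set)"
    and "F \<in> {0..1} \<rightarrow> {0..1}"
    and "mono_on {0..1} F"
    and "0 < \<gamma>" and "\<gamma> < 1"
    and "\<gamma>-lipschitz_on {0..1} F"
  shows "(\<exists>\<alpha>::'o. countable {..<\<alpha>} \<and> approx F \<alpha> = approx F (ord_suc \<alpha>)) \<and>
    (\<forall>\<alpha>::'o. \<alpha> < closure_ord F \<longrightarrow>
      \<bar>approx F (closure_ord F :: 'o) - approx F \<alpha>\<bar> \<le> ord_power \<gamma> \<alpha>) \<and>
    (\<forall>\<epsilon>. 0 < \<epsilon> \<and> \<epsilon> < 1 \<longrightarrow>
      (\<forall>\<alpha>::'o. ord_of_nat (nat \<lceil>log \<gamma> \<epsilon>\<rceil>) \<le> \<alpha> \<longrightarrow>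
        \<bar>approx F (closure_ord F :: 'o) - approx F \<alpha>\<bar> \<le> \<epsilon>))"
proof -
  let ?stationary = "\<lambda>a::'o. countable {..<a} \<and> approx F a = approx F (ord_suc a)"
  have "\<exists>!p\<in>{0..1}. F p = p"
  proof (rule Banach_fix)
    show "complete {0..1::real}"
      by (simp add: complete_eq_closed)
    show "F ` {0..1} \<subseteq> {0..1}"
      using assms(2) by blast
    show "dist (F x) (F y) \<le> \<gamma> * dist x y" if "x \<in> {0..1}" "y \<in> {0..1}" for x y
      using that by (rule lipschitz_onD[OF assms(6)])
  qed (use assms(4,5) in auto)
  then obtain p where p: "p \<in> {0..1}" "F p = p"
    and unique: "\<And>x. x \<in> {0..1} \<Longrightarrow> F x = x \<Longrightarrow> x = p"
    by blast
  have gap: "0 \<le> approx F a \<and> approx F a \<le> p \<and> p - approx F a \<le> ord_power \<gamma> a" for a :: 'o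
    by (rule approx_fixpoint_gap[OF assms(3-6,2) p])
  obtain w :: 'o where w: "countable {..<w}" "infinite {..<w}"
    using ex_countable_infinite_lessThan[OF assms(1)] by blast
  then obtain c where "w < c"
    using countable_imp_less[OF assms(1)] by blast
  \<comment> \<open>\<open>ord_power\<close> vanishes at \<open>w\<close>, which closes the
    gap.\<close>
  moreover have "approx F w = p"
    using gap[of w] w assms by (simp add: ord_power_eq)
  ultimately have ex: "?stationary w"
    using w p by (simp add: approx_suc)
  \<comment> \<open>The stage \<open>w\<close> ensures that the \<open>LEAST\<close> in
    \<open>closure_ord\<close> ranges over a nonempty set.\<close>
  then have "?stationary (closure_ord F)"
    unfolding closure_ord_def by (rule LeastI)
  \<comment> \<open>Countability of its initial segment gives \<open>closure_ord F\<close> a true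
    successor, so stationarity says that its value is fixed by \<open>F\<close>.\<close>
  moreover from this obtain d where "(closure_ord F :: 'o) < d"
    using countable_imp_less[OF assms(1)] by blast
  ultimately have "F (approx F (closure_ord F :: 'o)) = approx F (closure_ord F :: 'o)"
    by (metis approx_suc)
  then have kappa: "approx F (closure_ord F :: 'o) = p"
    using gap[of "closure_ord F"] p by (intro unique) auto
  \<comment> \<open>This covers all stages, including those from \<open>closure_ord F\<close> on,
    which the \<epsilon>-statement also reaches.\<close>
  have bound: "\<bar>approx F (closure_ord F :: 'o) - approx F a\<bar> \<le> ord_power \<gamma> a" for a :: 'o
    using gap[of a] by (simp add: kappa)
  moreover have "\<bar>approx F (closure_ord F :: 'o) - approx F a\<bar> \<le> \<epsilon>"
    if "0 < \<epsilon>" and a: "ord_of_nat (nat \<lceil>log \<gamma> \<epsilon>\<rceil>) \<le> a" for \<epsilon> and a :: 'o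
  proof -
    have "ord_power \<gamma> a \<le> \<gamma> ^ nat \<lceil>log \<gamma> \<epsilon>\<rceil>"
      using ord_power_antimono[OF assms(4,5) a] assms(4,5)
        finite_card_lessThan_ord_of_nat[OF assms(1), of "nat \<lceil>log \<gamma> \<epsilon>\<rceil>"]
      by (simp add: ord_power_eq)
    also have "\<dots> \<le> \<epsilon>"
      using assms(4,5) that(1) by (rule power_nat_ceiling_log_le)
    finally show ?thesis
      using bound[of a] by linarith
  qed
  ultimately show ?thesis
    using ex by blast
qed

end
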